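(* Let $n,d\ge1$, $N=\binom{n+d}{d}$ and $1\le k\le N$. A real polynomial $p$ of degree $2d$ in $n$ variables is $k$DDSOS if and only if it admits a representation $p(x)=m(x)^{\mathsf T}A\,m(x)$, where $m(x)=(m_1(x),\dots,m_N(x))^{\mathsf T}$ is the standard monomial vector of degree $d$ (the $N$ distinct monomials in $n$ variables of degree at most $d$) and $A\in(\mathbb{S}^N_+)_k$.
   Context: Let $m_1,\dots,m_N$ be an enumeration of all monomials in $n$ variables of degree at most $d$. A polynomial $p$ is $k$th-diagonally-dominant-sum-of-squares ($k$DDSOS) if it can be written as a finite sum $$p=\sum_{i_1,\dots,i_k}\sum_j\Bigl(\sum_{l=1}^k\alpha^{i_1\cdots i_k}_{j i_l}m_{i_l}\Bigr)^2,$$ where the outer sum is over tuples $(i_1,\dots,i_k)$ with $i_1,\dots,i_k\in\{1,\dots,N\}$ (not required to be increasing or distinct), the inner sum is over finitely many $j$, and the $\alpha$'s are real constants. $\mathbb{S}^N$ is the space of real symmetric $N\times N$ matrices, $\mathbb{S}^k_+$ the cone of real $k\times k$ positive semidefinite matrices. For $1\le i_1<\dots<i_k\le N$ the lift $\varepsilon^N_{i_1\cdots i_k}:\mathbb{S}^k\to\mathbb{S}^N$ sends $X$ to the matrix with $(i_p,i_q)$ entry $x_{pq}$ and all other entries $0$. $(\mathbb{S}^N_+)_k=\{\sum_{1\le i_1<\dots<i_k\le N}\varepsilon^N_{i_1\cdots i_k}(M_{i_1\cdots i_k}):M_{i_1\cdots i_k}\in\mathbb{S}^k_+\}$. *)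

theory Defs
  imports "HOL-Library.Poly_Mapping" "Jordan_Normal_Form.Matrix"
begin

text \<open>
  Real polynomials are finitely supported maps from exponent vectors to coefficients, with the
  convolution product; the variables are \<open>x\<^sub>0, x\<^sub>1, \<dots>\<close>.  All indices (of variables, monomials and
  matrix entries) start at 0.
\<close>

type_synonym monomial = "nat \<Rightarrow>\<^sub>0 nat"

type_synonym rpoly = "monomial \<Rightarrow>\<^sub>0 real"

definition mdeg :: "monomial \<Rightarrow> nat" where
  "mdeg t = (\<Sum>i\<in>Poly_Mapping.keys t. Poly_Mapping.lookup t i)"

definition monomials :: "nat \<Rightarrow> nat \<Rightarrow> monomial set" where
  "monomials n d = {t. Poly_Mapping.keys t \<subseteq> {..<n} \<and> mdeg t \<le> d}"

definition polys :: "nat \<Rightarrow> rpoly set" where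
  "polys n = {p. \<forall>t\<in>Poly_Mapping.keys p. Poly_Mapping.keys t \<subseteq> {..<n}}"

text \<open>The zero polynomial gets total degree 0.\<close>

definition total_degree :: "rpoly \<Rightarrow> nat" where
  "total_degree p = Max (insert 0 (mdeg ` Poly_Mapping.keys p))"

definition mono_poly :: "monomial \<Rightarrow> rpoly" where
  "mono_poly t = Poly_Mapping.single t 1"

definition const_poly :: "real \<Rightarrow> rpoly" where
  "const_poly c = Poly_Mapping.single 0 c"

definition monomial_vec :: "nat \<Rightarrow> (nat \<Rightarrow> monomial) \<Rightarrow> rpoly vec" where
  "monomial_vec N m = vec N (\<lambda>i. mono_poly (m i))"

text \<open>
  The outer sum ranges over all tuples, in any order and with repetitions.  As in the notation
  \<open>\<alpha>\<^bsup>i\<^sub>1\<cdots>i\<^sub>k\<^esup>\<close> with lower indices \<open>j\<close> and \<open>i\<^sub>l\<close>, the coefficient depends on the tuple, on \<open>j\<close>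
  and on the value \<open>i\<^sub>l\<close>, not on the position \<open>l\<close>.  The number \<open>J I\<close> of squares may vary with the tuple.
\<close>

definition kDDSOS :: "nat \<Rightarrow> (nat \<Rightarrow> monomial) \<Rightarrow> nat \<Rightarrow> rpoly \<Rightarrow> bool" where
  "kDDSOS N m k p \<longleftrightarrow>
    (\<exists>(J :: nat list \<Rightarrow> nat) (\<alpha> :: nat list \<Rightarrow> nat \<Rightarrow> nat \<Rightarrow> real).
      p = (\<Sum>I\<in>{I. length I = k \<and> set I \<subseteq> {..<N}}. \<Sum>j<J I.
             (\<Sum>l<k. const_poly (\<alpha> I j (I ! l)) * mono_poly (m (I ! l)))\<^sup>2))"

definition PSD :: "nat \<Rightarrow> real mat set" where
  "PSD k = {X \<in> carrier_mat k k. transpose_mat X = X \<and>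
              (\<forall>v\<in>carrier_vec k. v \<bullet> (X *\<^sub>v v) \<ge> 0)}"

definition increasing_tuples :: "nat \<Rightarrow> nat \<Rightarrow> nat list set" where
  "increasing_tuples N k = {I. length I = k \<and> set I \<subseteq> {..<N} \<and> sorted_wrt (<) I}"

text \<open>
  For a strictly increasing \<open>I\<close> at most one summand below is nonzero, so the entry at
  \<open>(I ! p, I ! q)\<close> is \<open>X $$ (p, q)\<close> and all other entries vanish.
\<close>

definition lift_mat :: "nat \<Rightarrow> nat list \<Rightarrow> real mat \<Rightarrow> real mat" where
  "lift_mat N I X = mat N N (\<lambda>(a, b).
     \<Sum>p<length I. \<Sum>q<length I. if I ! p = a \<and> I ! q = b then X $$ (p, q) else 0)"

text \<open>The sum of the lifted matrices is written entrywise, as \<open>mat\<close> has no zero common to all dimensions.\<close>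

definition PSD_sums :: "nat \<Rightarrow> nat \<Rightarrow> real mat set" where
  "PSD_sums N k = {mat N N (\<lambda>ab. \<Sum>I\<in>increasing_tuples N k. lift_mat N I (M I) $$ ab) | M.
     \<forall>I\<in>increasing_tuples N k. M I \<in> PSD k}"

end

theory Submission
  imports Defs
begin

text \<open>
  Both sides of the equivalence describe sums of quadratic forms in few monomials.  A matrix in the
  cone \<open>PSD_sums N k\<close> has as its polynomial \<open>m\<^sup>T A m\<close> the sum, over the increasing tuples \<open>I\<close>, of the
  quadratic forms of positive semidefinite \<open>k \<times> k\<close> matrices in the monomials indexed by \<open>I\<close>
  (\<open>polynomial_of_PSD_sum\<close>).  So the theorem comes down to comparing such forms with sums of squares
  of linear combinations of \<open>k\<close> monomials.

  From forms to squares: a positive semidefinite matrix is a Gram matrix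
  (\<open>psd_imp_gram\<close>, by successive Schur complements), and the form of a Gram matrix is a sum of
  squares (\<open>quad_form_gram\<close>).  An increasing tuple has distinct entries, so it does no harm that the
  coefficients in \<open>kDDSOS\<close> depend on the index \<open>I ! l\<close> and not on the position \<open>l\<close>.

  From squares to forms: a tuple with repetitions or in the wrong order still involves at most \<open>k\<close>
  indices, and because of \<open>k \<le> N\<close> these lie among the entries of some increasing tuple of length
  \<open>k\<close> (\<open>increasing_tuple_covering\<close>).  Each square is thus the square of a linear combination over an
  increasing tuple; the squares assigned to one tuple add up to the form of a Gram matrix, which is
  positive semidefinite (\<open>gram_PSD\<close>).
\<close>

section \<open>Positive semidefinite matrices are Gram matrices\<close>

text \<open>
  Splitting off the last variable completes a square.  With \<open>a = Q k k\<close> and \<open>u i = Q i k / sqrt a\<close> the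
  Schur complement \<open>Q i j - u i * u j\<close> is again positive semidefinite on the first \<open>k\<close> indices,
  because its value at \<open>x\<close> is the value of \<open>Q\<close> at the extension of \<open>x\<close> by the minimizing last
  coordinate.  The convention \<open>x / 0 = 0\<close> lets the same formulas serve for \<open>a = 0\<close>: then \<open>u\<close> is zero,
  nothing is split off, and the last column of \<open>Q\<close> must itself be zero, since otherwise the form
  could be made a nonconstant affine function of the last coordinate and would take negative values.
\<close>

lemma psd_imp_gram:
  fixes Q :: "nat \<Rightarrow> nat \<Rightarrow> real"
  assumes "\<And>i j. i < k \<Longrightarrow> j < k \<Longrightarrow> Q i j = Q j i"
    and "\<And>x. (\<Sum>i<k. \<Sum>j<k. x i * Q i j * x j) \<ge> 0"
  shows "\<exists>v. \<forall>i<k. \<forall>j<k. Q i j = (\<Sum>r<k. v r i * v r j)"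
  using assms
proof (induction k arbitrary: Q)
  case 0
  then show ?case by simp
next
  case (Suc k)
  note sym = Suc.prems(1) and psd = Suc.prems(2)
  define a where "a = Q k k"
  define u where "u i = Q i k / sqrt a" for i
  define s where "s x = (\<Sum>i<k. x i * Q i k)" for x :: "nat \<Rightarrow> real"
  have expand: "(\<Sum>i<k. \<Sum>j<k. x i * Q i j * x j) + 2 * t * s x + t\<^sup>2 * a \<ge> 0" for x t
  proof -
    define y where "y i = (if i < k then x i else t)" for i
    have "(\<Sum>i<Suc k. \<Sum>j<Suc k. y i * Q i j * y j) =
        (\<Sum>i<k. (\<Sum>j<k. y i * Q i j * y j) + y i * Q i k * y k) +
        ((\<Sum>j<k. y k * Q k j * y j) + y k * Q k k * y k)"
      by simp
    also have "\<dots> = (\<Sum>i<k. (\<Sum>j<k. x i * Q i j * x j) + x i * Q i k * t) +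
        ((\<Sum>j<k. t * Q j k * x j) + t * a * t)"
      by (simp add: y_def a_def sym cong: sum.cong_simp)
    also have "\<dots> = (\<Sum>i<k. \<Sum>j<k. x i * Q i j * x j) + 2 * t * s x + t\<^sup>2 * a"
      by (simp add: s_def sum.distrib sum_distrib_left power2_eq_square mult_ac)
    finally show ?thesis using psd[of y] by simp
  qed
  have a0: "a \<ge> 0" using expand[of "\<lambda>_. 0" 1] by (simp add: s_def)
  have column: "Q i k = 0" if "a = 0" "i < k" for i
  proof (rule ccontr)
    assume ne: "Q i k \<noteq> 0"
    define x where "x j = (if j = i then 1 else 0::real)" for j
    have "s x = (\<Sum>i'<k. if i' = i then Q i k else 0)"
      unfolding s_def by (intro sum.cong refl) (simp add: x_def)
    then have 1: "s x = Q i k" using \<open>i < k\<close> by simp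
    have "(\<Sum>i'<k. \<Sum>j<k. x i' * Q i' j * x j) =
        (\<Sum>i'<k. \<Sum>j<k. if j = i then if i' = i then Q i i else 0 else 0)"
      by (intro sum.cong refl) (simp add: x_def)
    also have "\<dots> = Q i i" using \<open>i < k\<close> by simp
    \<comment> \<open>Without a quadratic term in \<open>t\<close> the form is affine in \<open>t\<close>; this \<open>t\<close> gives it the value \<open>-1\<close>.\<close>
    finally show False
      using expand[of x "- (Q i i + 1) / (2 * Q i k)"] ne 1 \<open>a = 0\<close> by (simp add: field_simps)
  qed
  have "(\<Sum>i<k. \<Sum>j<k. x i * (Q i j - u i * u j) * x j) \<ge> 0" for x
  proof -
    have "(\<Sum>i<k. \<Sum>j<k. x i * (u i * u j) * x j) = (\<Sum>i<k. x i * u i)\<^sup>2"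
      by (simp add: power2_eq_square sum_product mult_ac)
    also have "(\<Sum>i<k. x i * u i) = s x / sqrt a"
      by (simp add: u_def s_def sum_divide_distrib)
    also have "(s x / sqrt a)\<^sup>2 = (s x)\<^sup>2 / a" using a0 by (simp add: power_divide)
    finally have "(\<Sum>i<k. \<Sum>j<k. x i * (Q i j - u i * u j) * x j) =
        (\<Sum>i<k. \<Sum>j<k. x i * Q i j * x j) - (s x)\<^sup>2 / a"
      by (simp add: algebra_simps sum_subtractf)
    moreover have "2 * (- s x / a) * s x + (- s x / a)\<^sup>2 * a = - (s x)\<^sup>2 / a"
      by (cases "a = 0") (simp_all add: field_simps power2_eq_square)
    ultimately show ?thesis using expand[of x "- s x / a"] by simp
  qed
  then obtain v where v: "\<forall>i<k. \<forall>j<k. Q i j - u i * u j = (\<Sum>r<k. v r i * v r j)"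
    using Suc.IH[of "\<lambda>i j. Q i j - u i * u j"] sym by (auto simp: mult.commute)
  define w where "w r i = (if r < k then if i < k then v r i else 0 else u i)" for r i
  have uk: "u i * u k = Q i k" if "i \<le> k" for i
    using that a0 column[of i] by (cases "a = 0"; cases "i = k") (auto simp: u_def a_def)
  have "Q i j = (\<Sum>r<Suc k. w r i * w r j)" if "i < Suc k" "j < Suc k" for i j
  proof (cases "i < k \<and> j < k")
    case True
    then have "(\<Sum>r<k. w r i * w r j) = Q i j - u i * u j" by (simp add: w_def v)
    then show ?thesis by (simp add: w_def)
  next
    case False
    then have "(\<Sum>r<k. w r i * w r j) = 0" by (auto simp: w_def intro!: sum.neutral)
    moreover have "u i * u j = Q i j"
      using False that uk[of i] uk[of j] sym[of i j] by (auto simp: less_Suc_eq mult.commute)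
    ultimately show ?thesis by (simp add: w_def)
  qed
  then show ?case by blast
qed

lemma scalar_prod_mult_mat_vec:
  fixes X :: "'a::comm_semiring_0 mat"
  assumes "X \<in> carrier_mat k k" "v \<in> carrier_vec k"
  shows "v \<bullet> (X *\<^sub>v v) = (\<Sum>p<k. \<Sum>q<k. v $ p * X $$ (p, q) * v $ q)"
  using assms
  by (auto simp: scalar_prod_def sum_distrib_left mult_ac atLeast0LessThan intro!: sum.cong)

lemma PSD_imp_gram:
  assumes "X \<in> PSD k"
  shows "\<exists>v. \<forall>p<k. \<forall>q<k. X $$ (p, q) = (\<Sum>r<k. v r p * v r q)"
proof (rule psd_imp_gram)
  have X: "X \<in> carrier_mat k k" "transpose_mat X = X" using assms by (auto simp: PSD_def)
  show "X $$ (p, q) = X $$ (q, p)" if "p < k" "q < k" for p q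
    using that X by (metis carrier_matD index_transpose_mat(1))
  show "(\<Sum>p<k. \<Sum>q<k. x p * X $$ (p, q) * x q) \<ge> 0" for x
  proof -
    have "vec k x \<bullet> (X *\<^sub>v vec k x) \<ge> 0" using assms by (auto simp: PSD_def)
    then show ?thesis by (simp add: scalar_prod_mult_mat_vec[OF X(1)])
  qed
qed

lemma gram_PSD:
  fixes w :: "'s \<Rightarrow> nat \<Rightarrow> real"
  shows "mat k k (\<lambda>(p, q). \<Sum>s\<in>S. w s p * w s q) \<in> PSD k" (is "?X \<in> _")
proof -
  have "v \<bullet> (?X *\<^sub>v v) \<ge> 0" if "v \<in> carrier_vec k" for v
  proof -
    have "v \<bullet> (?X *\<^sub>v v) = (\<Sum>p<k. \<Sum>q<k. \<Sum>s\<in>S. (v $ p * w s p) * (v $ q * w s q))"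
      unfolding scalar_prod_mult_mat_vec[OF mat_carrier that]
      by (intro sum.cong refl) (auto simp: sum_distrib_left sum_distrib_right intro!: sum.cong)
    also have "\<dots> = (\<Sum>p<k. \<Sum>s\<in>S. \<Sum>q<k. (v $ p * w s p) * (v $ q * w s q))"
      by (intro sum.cong refl) (rule sum.swap)
    also have "\<dots> = (\<Sum>s\<in>S. \<Sum>p<k. \<Sum>q<k. (v $ p * w s p) * (v $ q * w s q))"
      by (rule sum.swap)
    also have "\<dots> = (\<Sum>s\<in>S. (\<Sum>p<k. v $ p * w s p)\<^sup>2)"
      by (simp add: power2_eq_square sum_product)
    also have "\<dots> \<ge> 0" by (intro sum_nonneg) simp
    finally show ?thesis .
  qed
  then show ?thesis by (auto simp: PSD_def mult.commute)
qed

section \<open>Quadratic forms in polynomials\<close>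

lemma const_poly_0 [simp]: "const_poly 0 = 0"
  by (simp add: const_poly_def)

lemma const_poly_mult: "const_poly (a * b) = const_poly a * const_poly b"
  by (simp add: const_poly_def mult_single)

lemma const_poly_sum: "const_poly (\<Sum>s\<in>S. f s) = (\<Sum>s\<in>S. const_poly (f s))"
  by (induction S rule: infinite_finite_induct) (simp_all add: const_poly_def single_add)

definition quad_form :: "nat \<Rightarrow> real mat \<Rightarrow> (nat \<Rightarrow> rpoly) \<Rightarrow> rpoly" where
  "quad_form k X y = (\<Sum>p<k. \<Sum>q<k. const_poly (X $$ (p, q)) * (y p * y q))"

lemma quad_form_gram:
  assumes "\<And>p q. p < k \<Longrightarrow> q < k \<Longrightarrow> X $$ (p, q) = (\<Sum>s\<in>S. w s p * w s q)"
  shows "quad_form k X y = (\<Sum>s\<in>S. (\<Sum>p<k. const_poly (w s p) * y p)\<^sup>2)"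
proof -
  have "quad_form k X y =
      (\<Sum>p<k. \<Sum>q<k. \<Sum>s\<in>S. (const_poly (w s p) * y p) * (const_poly (w s q) * y q))"
    unfolding quad_form_def
    by (intro sum.cong refl)
      (simp add: assms const_poly_sum const_poly_mult sum_distrib_right, simp add: mult_ac)
  also have "\<dots> = (\<Sum>p<k. \<Sum>s\<in>S. \<Sum>q<k. (const_poly (w s p) * y p) * (const_poly (w s q) * y q))"
    by (intro sum.cong refl) (rule sum.swap)
  also have "\<dots> = (\<Sum>s\<in>S. \<Sum>p<k. \<Sum>q<k. (const_poly (w s p) * y p) * (const_poly (w s q) * y q))"
    by (rule sum.swap)
  finally show ?thesis by (simp add: power2_eq_square sum_product)
qed

lemma monomial_vec_form:
  assumes "A \<in> carrier_mat N N"
  shows "monomial_vec N m \<bullet> (map_mat const_poly A *\<^sub>v monomial_vec N m) =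
    quad_form N A (\<lambda>a. mono_poly (m a))"
  using assms
  by (subst scalar_prod_mult_mat_vec[where k = N])
    (auto simp: quad_form_def monomial_vec_def mult_ac intro!: sum.cong)

lemma quad_form_lift_mat:
  assumes "set I \<subseteq> {..<N}"
  shows "quad_form N (lift_mat N I X) y = quad_form (length I) X (\<lambda>p. y (I ! p))"
proof -
  let ?L = "{..<length I}"
  have *: "const_poly (lift_mat N I X $$ (a, b)) * (y a * y b) =
      (\<Sum>(p, q)\<in>?L \<times> ?L. if b = I ! q then if a = I ! p
         then const_poly (X $$ (p, q)) * (y (I ! p) * y (I ! q)) else 0 else 0)"
    if "a < N" "b < N" for a b
    using that
    by (auto simp: lift_mat_def const_poly_sum sum.cartesian_product sum_distrib_right
        intro!: sum.cong)
  have "quad_form N (lift_mat N I X) y = (\<Sum>a<N. \<Sum>b<N. \<Sum>(p, q)\<in>?L \<times> ?L.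
      if b = I ! q then if a = I ! p
      then const_poly (X $$ (p, q)) * (y (I ! p) * y (I ! q)) else 0 else 0)"
    unfolding quad_form_def using * by (intro sum.cong refl) auto
  also have "\<dots> = (\<Sum>a<N. \<Sum>(p, q)\<in>?L \<times> ?L. \<Sum>b<N.
      if b = I ! q then if a = I ! p
      then const_poly (X $$ (p, q)) * (y (I ! p) * y (I ! q)) else 0 else 0)"
    unfolding case_prod_unfold by (intro sum.cong refl) (rule sum.swap)
  also have "\<dots> = (\<Sum>(p, q)\<in>?L \<times> ?L. \<Sum>a<N. \<Sum>b<N.
      if b = I ! q then if a = I ! p
      then const_poly (X $$ (p, q)) * (y (I ! p) * y (I ! q)) else 0 else 0)"
    unfolding case_prod_unfold by (rule sum.swap)
  also have "\<dots> = (\<Sum>(p, q)\<in>?L \<times> ?L. const_poly (X $$ (p, q)) * (y (I ! p) * y (I ! q)))"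
  proof (intro sum.cong refl, clarify)
    fix p q assume "p < length I" "q < length I"
    then have "I ! p < N" "I ! q < N" using assms nth_mem by blast+
    then show "(\<Sum>a<N. \<Sum>b<N. if b = I ! q then if a = I ! p
        then const_poly (X $$ (p, q)) * (y (I ! p) * y (I ! q)) else 0 else 0) =
        const_poly (X $$ (p, q)) * (y (I ! p) * y (I ! q))"
      by simp
  qed
  finally show ?thesis by (simp add: quad_form_def sum.cartesian_product)
qed

lemma polynomial_of_PSD_sum:
  fixes M :: "nat list \<Rightarrow> real mat" and N k :: nat
  defines "A \<equiv> mat N N (\<lambda>ab. \<Sum>I\<in>increasing_tuples N k. lift_mat N I (M I) $$ ab)"
  shows "monomial_vec N m \<bullet> (map_mat const_poly A *\<^sub>v monomial_vec N m) =
    (\<Sum>I\<in>increasing_tuples N k. quad_form k (M I) (\<lambda>p. mono_poly (m (I ! p))))"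
proof -
  let ?T = "increasing_tuples N k" and ?y = "\<lambda>a. mono_poly (m a)"
  have "quad_form N A ?y =
      (\<Sum>a<N. \<Sum>b<N. \<Sum>I\<in>?T. const_poly (lift_mat N I (M I) $$ (a, b)) * (?y a * ?y b))"
    unfolding quad_form_def A_def
    by (intro sum.cong refl) (simp add: const_poly_sum sum_distrib_right)
  also have "\<dots> = (\<Sum>a<N. \<Sum>I\<in>?T. \<Sum>b<N. const_poly (lift_mat N I (M I) $$ (a, b)) * (?y a * ?y b))"
    by (intro sum.cong refl) (rule sum.swap)
  also have "\<dots> = (\<Sum>I\<in>?T. quad_form N (lift_mat N I (M I)) ?y)"
    unfolding quad_form_def by (rule sum.swap)
  also have "\<dots> = (\<Sum>I\<in>?T. quad_form k (M I) (\<lambda>p. ?y (I ! p)))"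
    by (intro sum.cong refl) (auto simp: increasing_tuples_def quad_form_lift_mat)
  finally show ?thesis by (simp add: monomial_vec_form A_def)
qed

section \<open>Tuples of indices\<close>

lemma finite_tuples: "finite {I. length I = k \<and> set I \<subseteq> {..<N::nat}}"
  using finite_lists_length_eq[of "{..<N}" k] by (simp add: conj_commute)

lemma increasing_tuple_covering:
  assumes "k \<le> N" "length I = k" "set I \<subseteq> {..<N}"
  shows "\<exists>K\<in>increasing_tuples N k. set I \<subseteq> set K"
proof -
  have "card (set I) \<le> k" using assms(2) card_length by blast
  then obtain B where B: "set I \<subseteq> B" "B \<subseteq> {..<N}" "card B = k"
    using exists_subset_between[of "set I" k "{..<N}"] assms by auto
  have "finite B" using B(2) finite_subset by blast
  then have "sorted_list_of_set B \<in> increasing_tuples N k \<and> set I \<subseteq> set (sorted_list_of_set B)"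
    using B by (simp add: increasing_tuples_def)
  then show ?thesis by blast
qed

lemma increasing_tuple_bij:
  assumes "K \<in> increasing_tuples N k"
  shows "bij_betw (\<lambda>p. K ! p) {..<k} (set K)"
  using assms by (auto simp: increasing_tuples_def strict_sorted_iff intro: bij_betw_nth)

text \<open>
  An index that occurs several times in \<open>I\<close> contributes its coefficient once per occurrence; these
  multiplicities are absorbed into the coefficients over \<open>K\<close>, which are 0 outside \<open>I\<close>.
\<close>

lemma linear_combination_over_covering_tuple:
  assumes K: "K \<in> increasing_tuples N k" and sub: "set I \<subseteq> set K" and len: "length I = k"
  shows "(\<Sum>l<k. const_poly (\<beta> (I ! l)) * y (I ! l)) =
    (\<Sum>p<k. const_poly (\<Sum>l<k. if I ! l = K ! p then \<beta> (I ! l) else 0) * y (K ! p))"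
proof -
  have "(\<Sum>p<k. const_poly (\<Sum>l<k. if I ! l = K ! p then \<beta> (I ! l) else 0) * y (K ! p)) =
      (\<Sum>c\<in>set K. const_poly (\<Sum>l<k. if I ! l = c then \<beta> (I ! l) else 0) * y c)"
    by (rule sum.reindex_bij_betw[OF increasing_tuple_bij[OF K]])
  also have "\<dots> = (\<Sum>c\<in>set K. \<Sum>l<k. if I ! l = c then const_poly (\<beta> (I ! l)) * y (I ! l) else 0)"
    by (auto simp: const_poly_sum sum_distrib_right intro!: sum.cong)
  also have "\<dots> = (\<Sum>l<k. \<Sum>c\<in>set K. if I ! l = c then const_poly (\<beta> (I ! l)) * y (I ! l) else 0)"
    by (rule sum.swap)
  also have "\<dots> = (\<Sum>l<k. const_poly (\<beta> (I ! l)) * y (I ! l))"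
  proof (intro sum.cong refl)
    fix l assume "l \<in> {..<k}"
    then have "I ! l \<in> set K" using sub len nth_mem by blast
    then show "(\<Sum>c\<in>set K. if I ! l = c then const_poly (\<beta> (I ! l)) * y (I ! l) else 0) =
        const_poly (\<beta> (I ! l)) * y (I ! l)" by simp
  qed
  finally show ?thesis by simp
qed

section \<open>Sums of squares in few monomials and sums of lifted matrices\<close>

lemma kDDSOS_imp_PSD_sum:
  assumes "k \<le> N" "kDDSOS N m k p"
  shows "\<exists>A\<in>PSD_sums N k. p = monomial_vec N m \<bullet> (map_mat const_poly A *\<^sub>v monomial_vec N m)"
proof -
  let ?S = "{I. length I = k \<and> set I \<subseteq> {..<N}}" and ?T = "increasing_tuples N k"
  let ?y = "\<lambda>a. mono_poly (m a)"
  obtain J :: "nat list \<Rightarrow> nat" and \<alpha> :: "nat list \<Rightarrow> nat \<Rightarrow> nat \<Rightarrow> real"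
    where p: "p = (\<Sum>I\<in>?S. \<Sum>j<J I. (\<Sum>l<k. const_poly (\<alpha> I j (I ! l)) * ?y (I ! l))\<^sup>2)"
    using assms(2) unfolding kDDSOS_def by blast
  have "\<forall>I\<in>?S. \<exists>K\<in>?T. set I \<subseteq> set K"
    using increasing_tuple_covering[OF assms(1)] by blast
  then obtain cover where cover: "\<And>I. I \<in> ?S \<Longrightarrow> cover I \<in> ?T \<and> set I \<subseteq> set (cover I)"
    by metis
  define w where "w K = (\<lambda>(I, j) p. \<Sum>l<k. if I ! l = K ! p then \<alpha> I j (I ! l) else 0)"
    for K :: "nat list"
  define R where "R K = (SIGMA I:{I\<in>?S. cover I = K}. {..<J I})" for K
  define M where "M K = mat k k (\<lambda>(p, q). \<Sum>s\<in>R K. w K s p * w K s q)" for K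
  have fT: "finite ?T" by (rule finite_subset[OF _ finite_tuples[of k N]]) (auto simp: increasing_tuples_def)
  have form: "quad_form k (M K) (\<lambda>p. ?y (K ! p)) =
      (\<Sum>I\<in>{I\<in>?S. cover I = K}. \<Sum>j<J I. (\<Sum>l<k. const_poly (\<alpha> I j (I ! l)) * ?y (I ! l))\<^sup>2)"
    if "K \<in> ?T" for K
  proof -
    have "quad_form k (M K) (\<lambda>p. ?y (K ! p)) =
        (\<Sum>s\<in>R K. (\<Sum>p<k. const_poly (w K s p) * ?y (K ! p))\<^sup>2)"
      by (rule quad_form_gram) (simp add: M_def)
    also have "\<dots> = (\<Sum>(I, j)\<in>R K. (\<Sum>l<k. const_poly (\<alpha> I j (I ! l)) * ?y (I ! l))\<^sup>2)"
    proof (intro sum.cong refl, clarify)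
      fix I j assume "(I, j) \<in> R K"
      then have "set I \<subseteq> set K" "length I = k" using cover by (auto simp: R_def)
      then show "(\<Sum>p<k. const_poly (w K (I, j) p) * ?y (K ! p))\<^sup>2 =
          (\<Sum>l<k. const_poly (\<alpha> I j (I ! l)) * ?y (I ! l))\<^sup>2"
        using linear_combination_over_covering_tuple[OF that, of I "\<alpha> I j" ?y]
        by (simp add: w_def)
    qed
    also have "\<dots> = (\<Sum>I\<in>{I\<in>?S. cover I = K}. \<Sum>j<J I.
        (\<Sum>l<k. const_poly (\<alpha> I j (I ! l)) * ?y (I ! l))\<^sup>2)"
      unfolding R_def
      by (subst sum.Sigma) (auto intro: finite_subset[OF _ finite_tuples[of k N]])
    finally show ?thesis .
  qed
  define A where "A = mat N N (\<lambda>ab. \<Sum>K\<in>?T. lift_mat N K (M K) $$ ab)"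
  have "p = (\<Sum>K\<in>?T. quad_form k (M K) (\<lambda>p. ?y (K ! p)))"
    unfolding p using cover
    by (subst sum.group[OF finite_tuples fT, of cover, symmetric]) (auto simp: form)
  then have "p = monomial_vec N m \<bullet> (map_mat const_poly A *\<^sub>v monomial_vec N m)"
    unfolding A_def polynomial_of_PSD_sum .
  moreover have "A \<in> PSD_sums N k"
    unfolding PSD_sums_def
    by (rule CollectI, rule exI[of _ M]) (simp add: A_def M_def gram_PSD)
  ultimately show ?thesis by blast
qed

lemma PSD_sum_imp_kDDSOS:
  assumes "A \<in> PSD_sums N k"
    and "p = monomial_vec N m \<bullet> (map_mat const_poly A *\<^sub>v monomial_vec N m)"
  shows "kDDSOS N m k p"
proof -
  let ?S = "{I. length I = k \<and> set I \<subseteq> {..<N}}" and ?T = "increasing_tuples N k"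
  let ?y = "\<lambda>a. mono_poly (m a)"
  obtain M where M: "\<And>I. I \<in> ?T \<Longrightarrow> M I \<in> PSD k"
    and A: "A = mat N N (\<lambda>ab. \<Sum>I\<in>?T. lift_mat N I (M I) $$ ab)"
    using assms(1) unfolding PSD_sums_def by blast
  have "\<forall>I\<in>?T. \<exists>v. \<forall>p<k. \<forall>q<k. M I $$ (p, q) = (\<Sum>r<k. v r p * v r q)"
    using M PSD_imp_gram by blast
  then obtain v where v: "\<And>I p q. I \<in> ?T \<Longrightarrow> p < k \<Longrightarrow> q < k \<Longrightarrow>
      M I $$ (p, q) = (\<Sum>r<k. v I r p * v I r q)"
    by metis
  define J where "J I = (if I \<in> ?T then k else 0)" for I
  define \<alpha> where "\<alpha> I r a = v I r (the_inv_into {..<k} (\<lambda>l. I ! l) a)" for I r a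
  have \<alpha>: "\<alpha> I r (I ! l) = v I r l" if "I \<in> ?T" "l < k" for I r l
    using increasing_tuple_bij[OF that(1)] that(2)
    by (simp add: \<alpha>_def bij_betw_def the_inv_into_f_f)
  have "p = (\<Sum>I\<in>?T. quad_form k (M I) (\<lambda>p. ?y (I ! p)))"
    unfolding assms(2) A polynomial_of_PSD_sum ..
  also have "\<dots> = (\<Sum>I\<in>?T. \<Sum>r<J I. (\<Sum>l<k. const_poly (\<alpha> I r (I ! l)) * ?y (I ! l))\<^sup>2)"
  proof (intro sum.cong refl)
    fix I assume I: "I \<in> ?T"
    show "quad_form k (M I) (\<lambda>p. ?y (I ! p)) =
        (\<Sum>r<J I. (\<Sum>l<k. const_poly (\<alpha> I r (I ! l)) * ?y (I ! l))\<^sup>2)"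
      using quad_form_gram[OF v[OF I]] I by (simp add: J_def \<alpha>)
  qed
  also have "\<dots> = (\<Sum>I\<in>?S. \<Sum>r<J I. (\<Sum>l<k. const_poly (\<alpha> I r (I ! l)) * ?y (I ! l))\<^sup>2)"
    by (rule sum.mono_neutral_left[OF finite_tuples]) (auto simp: J_def increasing_tuples_def)
  finally show ?thesis unfolding kDDSOS_def by blast
qed

theorem theorem4p3:
  fixes n d N k :: nat
    and m :: "nat \<Rightarrow> monomial"
    and p :: rpoly
  assumes "n \<ge> 1" and "d \<ge> 1"
    and "N = (n + d) choose d"
    and "1 \<le> k" and "k \<le> N"
    and "bij_betw m {..<N} (monomials n d)"
    and "p \<in> polys n" and "total_degree p = 2 * d"
  shows "kDDSOS N m k p \<longleftrightarrow>
    (\<exists>A\<in>PSD_sums N k.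
      p = monomial_vec N m \<bullet> (map_mat const_poly A *\<^sub>v monomial_vec N m))"
  using kDDSOS_imp_PSD_sum[OF \<open>k \<le> N\<close>] PSD_sum_imp_kDDSOS by blast

end
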